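(* Let $n\ge 1$ and let $g=(A,w)$ be an element of $\mathrm{Sp}(n)\ltimes\mathbb{H}^n$. Then the following are equivalent. (1) $g$ is strongly reversible in $\mathrm{Sp}(n)\ltimes\mathbb{H}^n$. (2) Every eigenvalue class of $A$ is either $\pm1$ or of even multiplicity. (3) $A$ is strongly reversible in $\mathrm{Sp}(n)$.
   Context: $\mathbb{H}$ is the division ring of Hamilton's quaternions, containing $\mathbb{C}=\mathbb{R}\oplus\mathbb{R}i$; $\mathbb{H}^n$ is a right $\mathbb{H}$-vector space of column vectors, on which matrices act on the left. $\mathrm{Sp}(n)=\{g\in \mathrm{GL}(n,\mathbb{H}) : \bar g^{\top} g=g\bar g^{\top}=I_n\}$. Elements of $\mathrm{Sp}(n)\ltimes\mathbb{H}^n$ are pairs $(A,w)$ with $A\in\mathrm{Sp}(n)$, $w\in\mathbb{H}^n$, acting as the affine maps $z\mapsto Az+w$; the group operation is composition. An element $g$ of a group $G$ is strongly reversible in $G$ if there is $h\in G$ with $h^2=1$ and $hgh^{-1}=g^{-1}$. Eigenvalues of $A\in\mathrm{Sp}(n)$ are right eigenvalues ($Av=v\lambda$, $v\ne0$); they occur in similarity classes $[\lambda]=\{\mu^{-1}\lambda\mu:\mu\in\mathbb{H}\setminus\{0\}\}$, called eigenvalue classes, and each class has a unique representative $e^{i\theta}$ with $\theta\in[0,\pi]$. Every $A\in \mathrm{Sp}(n)$ is conjugate in $\mathrm{Sp}(n)$ to $\mathrm{diag}(e^{i\theta_1},\dots,e^{i\theta_n})$ with all $\theta_s\in[0,\pi]$;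 the multiplicity of the class of $e^{i\theta}$ ($\theta\in[0,\pi]$) is the number of indices $s$ with $\theta_s=\theta$. *)

theory Defs
  imports "HOL-Analysis.Analysis" "HOL-Algebra.Group"
begin

codatatype quat = Quat (qRe: real) (qI: real) (qJ: real) (qK: real)

lemma quat_eqI:
  "\<lbrakk>qRe x = qRe y; qI x = qI y; qJ x = qJ y; qK x = qK y\<rbrakk> \<Longrightarrow> x = y"
  by (rule quat.expand) simp

lemma quat_eq_iff:
  "x = y \<longleftrightarrow> qRe x = qRe y \<and> qI x = qI y \<and> qJ x = qJ y \<and> qK x = qK y"
  by (auto intro: quat_eqI)

primcorec qcnj :: "quat \<Rightarrow> quat" where
  "qRe (qcnj x) = qRe x"
| "qI (qcnj x) = - qI x"
| "qJ (qcnj x) = - qJ x"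
| "qK (qcnj x) = - qK x"

definition qnorm2 :: "quat \<Rightarrow> real" where
  "qnorm2 x = (qRe x)\<^sup>2 + (qI x)\<^sup>2 + (qJ x)\<^sup>2 + (qK x)\<^sup>2"

instantiation quat :: division_ring
begin

primcorec zero_quat where
  "qRe 0 = 0" | "qI 0 = 0" | "qJ 0 = 0" | "qK 0 = 0"

primcorec one_quat where
  "qRe 1 = 1" | "qI 1 = 0" | "qJ 1 = 0" | "qK 1 = 0"

primcorec plus_quat where
  "qRe (x + y) = qRe x + qRe y"
| "qI (x + y) = qI x + qI y"
| "qJ (x + y) = qJ x + qJ y"
| "qK (x + y) = qK x + qK y"

primcorec uminus_quat where
  "qRe (- x) = - qRe x"
| "qI (- x) = - qI x"
| "qJ (- x) = - qJ x"
| "qK (- x) = - qK x"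

primcorec minus_quat where
  "qRe (x - y) = qRe x - qRe y"
| "qI (x - y) = qI x - qI y"
| "qJ (x - y) = qJ x - qJ y"
| "qK (x - y) = qK x - qK y"

primcorec times_quat where
  "qRe (x * y) = qRe x * qRe y - qI x * qI y - qJ x * qJ y - qK x * qK y"
| "qI (x * y) = qRe x * qI y + qI x * qRe y + qJ x * qK y - qK x * qJ y"
| "qJ (x * y) = qRe x * qJ y - qI x * qK y + qJ x * qRe y + qK x * qI y"
| "qK (x * y) = qRe x * qK y + qI x * qJ y - qJ x * qI y + qK x * qRe y"

primcorec inverse_quat where
  "qRe (inverse x) = qRe x / qnorm2 x"
| "qI (inverse x) = - qI x / qnorm2 x"
| "qJ (inverse x) = - qJ x / qnorm2 x"
| "qK (inverse x) = - qK x / qnorm2 x"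

definition divide_quat :: "quat \<Rightarrow> quat \<Rightarrow> quat" where
  "divide_quat x y = x * inverse y"

instance
proof
  fix x y z :: quat
  show "x * y * z = x * (y * z)"
    by (simp add: quat_eq_iff algebra_simps)
  show "(x + y) * z = x * z + y * z" "x * (y + z) = x * y + x * z"
    by (simp_all add: quat_eq_iff algebra_simps)
  show "inverse x * x = 1" "x * inverse x = 1" if "x \<noteq> 0"
  proof -
    have "qnorm2 x \<noteq> 0"
      using that unfolding qnorm2_def quat_eq_iff
      by (auto simp: add_nonneg_eq_0_iff)
    then show "inverse x * x = 1" "x * inverse x = 1"
      by (simp_all add: quat_eq_iff divide_simps)
        (simp_all add: qnorm2_def power2_eq_square algebra_simps)
  qed
qed (simp_all add: quat_eq_iff divide_quat_def)

end

lemma qcnj_mult: "qcnj (x * y) = qcnj y * qcnj x"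
  and qcnj_add: "qcnj (x + y) = qcnj x + qcnj y"
  and qcnj_0 [simp]: "qcnj 0 = 0"
  and qcnj_1 [simp]: "qcnj 1 = 1"
  and qcnj_qcnj [simp]: "qcnj (qcnj x) = x"
  by (simp_all add: quat_eq_iff algebra_simps)

lemma qcnj_sum: "qcnj (sum f S) = (\<Sum>s\<in>S. qcnj (f s))"
  by (induction S rule: infinite_finite_induct) (simp_all add: qcnj_add)

definition quat_of_complex :: "complex \<Rightarrow> quat" where
  "quat_of_complex z = Quat (Re z) (Im z) 0 0"

definition qcis :: "real \<Rightarrow> quat" where
  "qcis \<theta> = quat_of_complex (cis \<theta>)"

definition conj_transpose :: "quat^'n^'m \<Rightarrow> quat^'m^'n" where
  "conj_transpose A = (\<chi> i j. qcnj (A $ j $ i))"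

definition Sp :: "(quat^'n^'n) monoid" where
  "Sp = \<lparr>carrier = {A. invertible A \<and> conj_transpose A ** A = mat 1 \<and> A ** conj_transpose A = mat 1},
         mult = (**), one = mat 1\<rparr>"

text \<open>The pair \<open>(A, w)\<close> stands for the affine map \<open>z \<mapsto> A z + w\<close>.\<close>

definition affine_act :: "(quat^'n^'n) \<times> (quat^'n) \<Rightarrow> quat^'n \<Rightarrow> quat^'n" where
  "affine_act g z = fst g *v z + snd g"

definition Sp_affine :: "((quat^'n^'n) \<times> (quat^'n)) monoid" where
  "Sp_affine = \<lparr>carrier = carrier Sp \<times> UNIV,
         mult = (\<lambda>(A, v) (B, w). (A ** B, A *v w + v)), one = (mat 1, 0)\<rparr>"

lemma affine_act_mult:
  "affine_act (g \<otimes>\<^bsub>Sp_affine\<^esub> h) = affine_act g \<circ> affine_act h"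
  by (auto simp: fun_eq_iff affine_act_def Sp_affine_def split_beta
      matrix_vector_mul_assoc matrix_vector_right_distrib algebra_simps)

lemma conj_transpose_mult: "conj_transpose (A ** B) = conj_transpose B ** conj_transpose A"
  by (simp add: vec_eq_iff conj_transpose_def matrix_matrix_mult_def qcnj_sum qcnj_mult)

lemma conj_transpose_mat_1 [simp]: "conj_transpose (mat 1) = mat 1"
  by (simp add: vec_eq_iff conj_transpose_def mat_def)

lemma conj_transpose_conj_transpose [simp]: "conj_transpose (conj_transpose A) = A"
  by (simp add: vec_eq_iff conj_transpose_def)

lemma carrier_Sp:
  "A \<in> carrier Sp \<longleftrightarrow> conj_transpose A ** A = mat 1 \<and> A ** conj_transpose A = mat 1"
  by (auto simp: Sp_def invertible_def)

lemma conj_transpose_in_Sp: "A \<in> carrier Sp \<Longrightarrow> conj_transpose A \<in> carrier Sp"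
  by (simp add: carrier_Sp)

lemma mult_in_Sp:
  assumes "A \<in> carrier Sp" "B \<in> carrier Sp"
  shows "A ** B \<in> carrier Sp"
proof -
  have "conj_transpose B ** conj_transpose A ** (A ** B)
      = conj_transpose B ** (conj_transpose A ** A) ** B"
    "A ** B ** (conj_transpose B ** conj_transpose A)
      = A ** (B ** conj_transpose B) ** conj_transpose A"
    by (simp_all add: matrix_mul_assoc)
  then show ?thesis
    using assms by (simp add: carrier_Sp conj_transpose_mult)
qed

lemma group_Sp: "group (Sp :: (quat^'n^'n) monoid)"
proof (rule groupI)
  fix A :: "quat^'n^'n"
  assume A: "A \<in> carrier Sp"
  show "\<exists>B\<in>carrier Sp. B \<otimes>\<^bsub>Sp\<^esub> A = \<one>\<^bsub>Sp\<^esub>"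
    using A by (intro bexI[of _ "conj_transpose A"] conj_transpose_in_Sp) (simp_all add: Sp_def)
next
  show "\<one>\<^bsub>Sp\<^esub> \<in> carrier (Sp :: (quat^'n^'n) monoid)"
    unfolding carrier_Sp by (simp add: Sp_def)
next
  fix A B :: "quat^'n^'n"
  assume "A \<in> carrier Sp" "B \<in> carrier Sp"
  then show "A \<otimes>\<^bsub>Sp\<^esub> B \<in> carrier Sp"
    using mult_in_Sp[of A B] by (simp add: Sp_def)
qed (simp_all add: Sp_def matrix_mul_assoc)

lemma group_Sp_affine: "group (Sp_affine :: ((quat^'n^'n) \<times> (quat^'n)) monoid)"
proof (rule groupI)
  fix g :: "(quat^'n^'n) \<times> (quat^'n)"
  assume g: "g \<in> carrier Sp_affine"
  obtain A w where [simp]: "g = (A, w)" by force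
  have A: "A \<in> carrier Sp" using g by (simp add: Sp_affine_def)
  let ?B = "conj_transpose A"
  show "\<exists>h\<in>carrier Sp_affine. h \<otimes>\<^bsub>Sp_affine\<^esub> g = \<one>\<^bsub>Sp_affine\<^esub>"
    using A conj_transpose_in_Sp[OF A]
    by (intro bexI[of _ "(?B, - (?B *v w))"]) (simp_all add: Sp_affine_def carrier_Sp)
next
  show "\<one>\<^bsub>Sp_affine\<^esub> \<in> carrier (Sp_affine :: ((quat^'n^'n) \<times> (quat^'n)) monoid)"
    by (simp add: Sp_affine_def carrier_Sp)
qed (auto simp: Sp_affine_def mult_in_Sp matrix_mul_assoc matrix_vector_mul_assoc
      matrix_vector_right_distrib algebra_simps)

definition strongly_reversible :: "('a, 'b) monoid_scheme \<Rightarrow> 'a \<Rightarrow> bool" where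
  "strongly_reversible G g \<longleftrightarrow>
     (\<exists>h\<in>carrier G. h [^]\<^bsub>G\<^esub> (2::nat) = \<one>\<^bsub>G\<^esub> \<and>
        h \<otimes>\<^bsub>G\<^esub> g \<otimes>\<^bsub>G\<^esub> inv\<^bsub>G\<^esub> h = inv\<^bsub>G\<^esub> g)"

definition right_eigenvalue :: "quat^'n^'n \<Rightarrow> quat \<Rightarrow> bool" where
  "right_eigenvalue A \<alpha> \<longleftrightarrow> (\<exists>v. v \<noteq> 0 \<and> A *v v = (\<chi> s. v $ s * \<alpha>))"

definition similarity_class :: "quat \<Rightarrow> quat set" where
  "similarity_class \<alpha> = {inverse \<mu> * \<alpha> * \<mu> | \<mu>. \<mu> \<noteq> 0}"

definition eigenvalue_classes :: "quat^'n^'n \<Rightarrow> quat set set" where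
  "eigenvalue_classes A = {similarity_class \<alpha> | \<alpha>. right_eigenvalue A \<alpha>}"

definition qdiag :: "('n \<Rightarrow> quat) \<Rightarrow> quat^'n^'n" where
  "qdiag d = (\<chi> i j. if i = j then d i else 0)"

definition diagonal_angles :: "quat^'n^'n \<Rightarrow> ('n \<Rightarrow> real) \<Rightarrow> bool" where
  "diagonal_angles A \<theta> \<longleftrightarrow> (\<forall>s. \<theta> s \<in> {0..pi}) \<and>
     (\<exists>U\<in>carrier Sp. U \<otimes>\<^bsub>Sp\<^esub> A \<otimes>\<^bsub>Sp\<^esub> inv\<^bsub>Sp\<^esub> U = qdiag (\<lambda>s. qcis (\<theta> s)))"

definition class_angle :: "quat set \<Rightarrow> real" where
  "class_angle C = (THE \<theta>. \<theta> \<in> {0..pi} \<and> qcis \<theta> \<in> C)"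

text \<open>The number of indices is the same for every diagonalisation of \<open>A\<close>; see
  \<open>diagonal_angles_card_unique\<close> and \<open>class_multiplicity_eq\<close> below.\<close>

definition class_multiplicity :: "quat^'n^'n \<Rightarrow> quat set \<Rightarrow> nat" where
  "class_multiplicity A C =
     (THE m. \<exists>\<theta>. diagonal_angles A \<theta> \<and> m = card {s. \<theta> s = class_angle C})"

lemma qRe_mult_commute: "qRe (x * y) = qRe (y * x)"
  by (simp add: algebra_simps)

lemma qRe_similar: "\<mu> \<noteq> 0 \<Longrightarrow> qRe (inverse \<mu> * \<alpha> * \<mu>) = qRe \<alpha>"
  by (metis qRe_mult_commute mult.assoc mult.right_neutral right_inverse)

lemma qRe_qcis [simp]: "qRe (qcis \<theta>) = cos \<theta>"
  by (simp add: qcis_def quat_of_complex_def)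

lemma class_angle_similarity_class:
  assumes "\<theta> \<in> {0..pi}"
  shows "class_angle (similarity_class (qcis \<theta>)) = \<theta>"
  unfolding class_angle_def
proof (rule the_equality)
  have "\<exists>\<mu>. qcis \<theta> = inverse \<mu> * qcis \<theta> * \<mu> \<and> \<mu> \<noteq> 0"
    by (rule exI[of _ 1]) simp
  then show "\<theta> \<in> {0..pi} \<and> qcis \<theta> \<in> similarity_class (qcis \<theta>)"
    using assms by (simp add: similarity_class_def)
next
  fix \<phi> assume \<phi>: "\<phi> \<in> {0..pi} \<and> qcis \<phi> \<in> similarity_class (qcis \<theta>)"
  then obtain \<mu> where "\<mu> \<noteq> 0" "qcis \<phi> = inverse \<mu> * qcis \<theta> * \<mu>"
    by (auto simp: similarity_class_def)
  then have "cos \<phi> = cos \<theta>" by (metis qRe_similar qRe_qcis)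
  then show "\<phi> = \<theta>" using \<phi> assms cos_inj_pi by auto
qed

lemma qdiag_mult: "(qdiag d ** V) $ i $ j = d i * V $ i $ j"
  and mult_qdiag: "(V ** qdiag d) $ i $ j = V $ i $ j * d j"
  by (simp_all add: matrix_matrix_mult_def qdiag_def if_distrib if_distribR cong: if_cong)

lemma diagonal_angles_card_unique:
  fixes A :: "quat^'n^'n"
  assumes "diagonal_angles A \<theta>" "diagonal_angles A \<phi>"
  shows "card {s. \<theta> s = t} = card {s. \<phi> s = t}"
proof -
  interpret Sp: group "Sp :: (quat^'n^'n) monoid" by (rule group_Sp)
  have mult_Sp: "U \<otimes>\<^bsub>Sp\<^esub> V = U ** V" for U V :: "quat^'n^'n"
    by (simp add: Sp_def)
  have inv_Sp: "inv\<^bsub>Sp\<^esub> U = conj_transpose U" if "U \<in> carrier Sp" for U :: "quat^'n^'n"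
    using that conj_transpose_in_Sp[OF that]
    by (intro Sp.inv_equality) (simp_all add: Sp_def)
  obtain U where U: "U \<in> carrier Sp" and Ud: "U ** A ** conj_transpose U = qdiag (\<lambda>s. qcis (\<theta> s))"
    using assms(1) unfolding diagonal_angles_def by (auto simp: mult_Sp inv_Sp)
  obtain V where V: "V \<in> carrier Sp" and Vd: "V ** A ** conj_transpose V = qdiag (\<lambda>s. qcis (\<phi> s))"
    using assms(2) unfolding diagonal_angles_def by (auto simp: mult_Sp inv_Sp)
  define W where "W = V ** conj_transpose U"
  have W: "W \<in> carrier Sp"
    unfolding W_def by (intro mult_in_Sp conj_transpose_in_Sp U V)
  have "W ** qdiag (\<lambda>s. qcis (\<theta> s)) = V ** (conj_transpose U ** U) ** A ** conj_transpose U"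
    unfolding W_def Ud[symmetric] by (simp add: matrix_mul_assoc)
  also have "\<dots> = V ** A ** (conj_transpose V ** V) ** conj_transpose U"
    using U V by (simp add: carrier_Sp)
  also have "\<dots> = qdiag (\<lambda>s. qcis (\<phi> s)) ** W"
    unfolding W_def Vd[symmetric] by (simp add: matrix_mul_assoc)
  finally have comm: "W $ i $ j * qcis (\<theta> j) = qcis (\<phi> i) * W $ i $ j" for i j
    by (metis qdiag_mult mult_qdiag)
  have block: "W $ i $ j = 0" if "\<phi> i \<noteq> \<theta> j" for i j
  proof (rule ccontr)
    assume nz: "W $ i $ j \<noteq> 0"
    have "qcis (\<theta> j) = inverse (W $ i $ j) * (W $ i $ j * qcis (\<theta> j))"
      using nz by (simp flip: mult.assoc)
    also have "\<dots> = inverse (W $ i $ j) * qcis (\<phi> i) * W $ i $ j"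
      by (simp add: comm mult.assoc)
    finally have "cos (\<theta> j) = cos (\<phi> i)" using nz by (metis qRe_similar qRe_qcis)
    then show False
      using that assms cos_inj_pi unfolding diagonal_angles_def by (metis atLeastAtMost_iff)
  qed
  have qnorm2: "qnorm2 x = qRe (qcnj x * x)" "qnorm2 x = qRe (x * qcnj x)" for x
    by (simp_all add: qnorm2_def power2_eq_square)
  have qRe_sum: "qRe (sum f S) = (\<Sum>s\<in>S. qRe (f s))" for f :: "'n \<Rightarrow> quat" and S
    by (induction S rule: infinite_finite_induct) simp_all
  have col: "(\<Sum>i\<in>UNIV. qnorm2 (W $ i $ j)) = 1" for j
  proof -
    have "(\<Sum>i\<in>UNIV. qnorm2 (W $ i $ j)) = qRe ((conj_transpose W ** W) $ j $ j)"
      by (simp only: qnorm2(1) qRe_sum matrix_matrix_mult_def conj_transpose_def vec_lambda_beta)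
    then show ?thesis using W by (simp add: carrier_Sp mat_def)
  qed
  have row: "(\<Sum>j\<in>UNIV. qnorm2 (W $ i $ j)) = 1" for i
  proof -
    have "(\<Sum>j\<in>UNIV. qnorm2 (W $ i $ j)) = qRe ((W ** conj_transpose W) $ i $ i)"
      by (simp only: qnorm2(2) qRe_sum matrix_matrix_mult_def conj_transpose_def vec_lambda_beta)
    then show ?thesis using W by (simp add: carrier_Sp mat_def)
  qed
  let ?S = "{s. \<theta> s = t}" and ?T = "{s. \<phi> s = t}"
  have col': "(\<Sum>i\<in>?T. qnorm2 (W $ i $ j)) = 1" if "j \<in> ?S" for j
    using that unfolding col[of j, symmetric]
    by (intro sum.mono_neutral_left) (auto simp: qnorm2_def block)
  have row': "(\<Sum>j\<in>?S. qnorm2 (W $ i $ j)) = 1" if "i \<in> ?T" for i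
    using that unfolding row[of i, symmetric]
    by (intro sum.mono_neutral_left) (auto simp: qnorm2_def block)
  have "real (card ?S) = (\<Sum>j\<in>?S. \<Sum>i\<in>?T. qnorm2 (W $ i $ j))"
    using col' by simp
  also have "\<dots> = real (card ?T)"
    by (subst sum.swap) (use row' in simp)
  finally show ?thesis by simp
qed

lemma class_multiplicity_eq:
  assumes "diagonal_angles A \<theta>"
  shows "class_multiplicity A C = card {s. \<theta> s = class_angle C}"
  unfolding class_multiplicity_def
  using assms diagonal_angles_card_unique by (intro the_equality) blast+

end

theory Submission
  imports Defs
begin

text \<open>Diagonalise \<open>A\<close> with angles in \<open>[0, \<pi>]\<close>. A matrix reversing the diagonal form preserves
  the blocks of equal angles; on a block with \<open>0 < t < \<pi>\<close> it is \<open>C j\<close> with \<open>C\<close> complex, and a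
  determinant argument shows that such an involution needs a block of even size. Conversely, on an
  even block pair the coordinates and take \<open>j\<close> and \<open>- j\<close> as the off-diagonal entries of each pair.
  Together with \<open>1\<close> on the block of \<open>\<pi>\<close> and \<open>- 1\<close> on the block of \<open>0\<close>, this also reverses the
  translation part once a conjugation by a translation has moved that into the fixed space.\<close>

section \<open>Quaternions as a Euclidean space\<close>

text \<open>The real Euclidean structure makes \<open>quat^'n\<close> a real Euclidean space of
  dimension 4n, which supplies compact unit spheres, dimension counts and real orthogonal
  complements.\<close>

instantiation quat :: real_algebra
begin

primcorec scaleR_quat where
  "qRe (r *\<^sub>R x) = r * qRe x"
| "qI (r *\<^sub>R x) = r * qI x"
| "qJ (r *\<^sub>R x) = r * qJ x"
| "qK (r *\<^sub>R x) = r * qK x"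

instance
  by standard (simp_all add: quat_eq_iff algebra_simps)

end

instantiation quat :: real_inner
begin

definition inner_quat :: "quat \<Rightarrow> quat \<Rightarrow> real" where
  "inner_quat x y = qRe x * qRe y + qI x * qI y + qJ x * qJ y + qK x * qK y"

definition norm_quat :: "quat \<Rightarrow> real" where
  "norm_quat x = sqrt (inner x x)"

definition sgn_quat :: "quat \<Rightarrow> quat" where
  "sgn_quat x = x /\<^sub>R norm x"

definition dist_quat :: "quat \<Rightarrow> quat \<Rightarrow> real" where
  "dist_quat x y = norm (x - y)"

definition uniformity_quat :: "(quat \<times> quat) filter" where
  "uniformity_quat = (INF e\<in>{0 <..}. principal {(x, y). dist x y < e})"

definition open_quat :: "quat set \<Rightarrow> bool" where
  "open_quat U \<longleftrightarrow> (\<forall>x\<in>U. eventually (\<lambda>(x', y). x' = x \<longrightarrow> y \<in> U) uniformity)"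

instance
proof
  fix x y z :: quat and a b :: real and U :: "quat set"
  show "sgn x = inverse (norm x) *\<^sub>R x" "dist x y = norm (x - y)" "norm x = sqrt (inner x x)"
    by (simp_all add: sgn_quat_def dist_quat_def norm_quat_def)
  show "(uniformity :: (quat \<times> quat) filter) = (INF e\<in>{0 <..}. principal {(x, y). dist x y < e})"
    by (rule uniformity_quat_def)
  show "open U \<longleftrightarrow> (\<forall>x\<in>U. \<forall>\<^sub>F (x', y) in uniformity. x' = x \<longrightarrow> y \<in> U)"
    by (rule open_quat_def)
  show "inner x y = inner y x" "inner (x + y) z = inner x z + inner y z"
    "inner (a *\<^sub>R x) y = a * inner x y" "0 \<le> inner x x"
    by (simp_all add: inner_quat_def algebra_simps)
  show "inner x x = 0 \<longleftrightarrow> x = 0"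
    by (auto simp: inner_quat_def quat_eq_iff add_nonneg_eq_0_iff)
qed

end

instantiation quat :: euclidean_space
begin

definition Basis_quat :: "quat set" where
  "Basis_quat = {Quat 1 0 0 0, Quat 0 1 0 0, Quat 0 0 1 0, Quat 0 0 0 1}"

instance
proof
  fix u v x :: quat
  show "Basis \<noteq> ({} :: quat set)" "finite (Basis :: quat set)"
    by (simp_all add: Basis_quat_def)
  show "inner u v = (if u = v then 1 else 0)" if "u \<in> Basis" "v \<in> Basis"
    using that unfolding Basis_quat_def by (elim insertE) (simp_all add: inner_quat_def)
  show "(\<forall>u\<in>Basis. inner x u = 0) \<longleftrightarrow> x = 0"
    by (simp add: Basis_quat_def inner_quat_def quat_eq_iff[of x 0])
qed

end

lemma DIM_quat [simp]: "DIM(quat) = 4"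
  by (simp add: Basis_quat_def)

lemma qRe_sum: "qRe (sum f S) = (\<Sum>s\<in>S. qRe (f s))"
  by (induction S rule: infinite_finite_induct) simp_all

lemma inner_quat_eq: "inner x y = qRe (qcnj x * y)"
  by (simp add: inner_quat_def)

section \<open>The quaternionic Hermitian form\<close>

text \<open>With the conjugate on the left argument, right scalars leave at the two ends: the form
  of \<open>rscale x p\<close> and \<open>rscale y q\<close> is
  \<open>qcnj p * qinner x y * q\<close>.\<close>

definition qinner :: "quat^'n \<Rightarrow> quat^'n \<Rightarrow> quat" where
  "qinner x y = (\<Sum>s\<in>UNIV. qcnj (x $ s) * y $ s)"

text \<open>Scalars act from the right so that matrices, acting from the left, are linear for
  them.\<close>

definition rscale :: "quat^'n \<Rightarrow> quat \<Rightarrow> quat^'n" where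
  "rscale x q = (\<chi> s. x $ s * q)"

lemma rscale_nth [simp]: "rscale x q $ s = x $ s * q"
  by (simp add: rscale_def)

lemma qRe_qinner: "qRe (qinner x y) = inner x y"
  by (simp add: qinner_def qRe_sum inner_vec_def inner_quat_eq del: times_quat.simps)

lemma qinner_rscale_left: "qinner (rscale x q) y = qcnj q * qinner x y"
  by (simp add: qinner_def qcnj_mult sum_distrib_left mult.assoc)

lemma qinner_rscale_right: "qinner x (rscale y q) = qinner x y * q"
  by (simp add: qinner_def sum_distrib_right mult.assoc)

lemma qinner_add_right: "qinner x (y + z) = qinner x y + qinner x z"
  by (simp add: qinner_def sum.distrib distrib_left)

lemma qinner_scaleR_right: "qinner x (r *\<^sub>R y) = r *\<^sub>R qinner x y"
  by (simp add: qinner_def scaleR_right.sum)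

lemma qinner_zero_right [simp]: "qinner x 0 = 0"
  by (simp add: qinner_def)

lemma qcnj_qinner: "qcnj (qinner x y) = qinner y x"
  by (simp add: qinner_def qcnj_sum qcnj_mult)

lemma qinner_self: "qinner x x = inner x x *\<^sub>R 1"
proof -
  have "qcnj (qinner x x) = qinner x x" by (rule qcnj_qinner)
  then show ?thesis by (auto simp: quat_eq_iff simp flip: qRe_qinner)
qed

lemma qinner_mult_vec: "qinner (A *v x) y = qinner x (conj_transpose A *v y)"
proof -
  have "qinner (A *v x) y = (\<Sum>i\<in>UNIV. \<Sum>j\<in>UNIV. qcnj (x $ j) * (qcnj (A $ i $ j) * y $ i))"
    by (simp add: qinner_def matrix_vector_mult_def qcnj_sum qcnj_mult sum_distrib_right mult.assoc)
  also have "\<dots> = qinner x (conj_transpose A *v y)"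
    by (subst sum.swap)
      (simp add: qinner_def matrix_vector_mult_def conj_transpose_def sum_distrib_left)
  finally show ?thesis .
qed

lemma mult_vec_rscale: "A *v rscale x q = rscale (A *v x) q"
  by (simp add: vec_eq_iff matrix_vector_mult_def sum_distrib_right mult.assoc)

lemma linear_mult_vec: "linear ((*v) A)" for A :: "quat^'n^'m"
  by (rule linearI)
    (simp_all add: vec_eq_iff matrix_vector_mult_def distrib_left sum.distrib scaleR_right.sum)

lemma rscale_add_right: "rscale x (p + q) = rscale x p + rscale x q"
  by (simp add: vec_eq_iff distrib_left)

lemma rscale_rscale: "rscale (rscale x p) q = rscale x (p * q)"
  by (simp add: vec_eq_iff mult.assoc)

lemma rscale_eq_0_iff: "rscale x q = 0 \<longleftrightarrow> x = 0 \<or> q = 0"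
  by (auto simp: vec_eq_iff)

section \<open>Diagonalisation in the symplectic group\<close>

text \<open>A maximiser \<open>v\<close> of the Rayleigh quotient on the unit sphere of
  \<open>S\<close> is an eigenvector: otherwise moving from \<open>v\<close> along the residual
  \<open>T v - c v\<close>, which stays in \<open>S\<close>, would increase the quotient.\<close>

lemma self_adjoint_eigenvector:
  fixes T :: "'a::euclidean_space \<Rightarrow> 'a"
  assumes T: "linear T" and adj: "\<And>x y. inner x (T y) = inner (T x) y"
    and S: "subspace S" and inv: "\<And>x. x \<in> S \<Longrightarrow> T x \<in> S" and x0: "x0 \<in> S" "x0 \<noteq> 0"
  obtains v c where "v \<in> S" "v \<noteq> 0" "T v = c *\<^sub>R v"
proof -
  let ?K = "S \<inter> sphere 0 1"
  have "compact ?K"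
    using S by (intro closed_Int_compact closed_subspace) auto
  moreover have "(1 / norm x0) *\<^sub>R x0 \<in> ?K"
    using x0 S by (auto simp: subspace_scale)
  moreover have "continuous_on ?K (\<lambda>x. inner x (T x))"
    using T by (intro continuous_intros linear_continuous_on) (simp add: linear_conv_bounded_linear)
  ultimately obtain v where v: "v \<in> ?K" and max: "\<And>x. x \<in> ?K \<Longrightarrow> inner x (T x) \<le> inner v (T v)"
    using continuous_attains_sup[of ?K "\<lambda>x. inner x (T x)"] by blast
  define c where "c = inner v (T v)"
  have bound: "inner x (T x) \<le> c * inner x x" if "x \<in> S" for x
  proof (cases "x = 0")
    case False
    let ?y = "(1 / norm x) *\<^sub>R x"
    have "?y \<in> ?K" using that False S by (auto simp: subspace_scale)
    then have "inner ?y (T ?y) \<le> c" using max c_def by blast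
    then have "inner x (T x) / (norm x)\<^sup>2 \<le> c"
      by (simp add: linear_cmul[OF T] power2_eq_square)
    then show ?thesis using False by (simp add: divide_simps power2_norm_eq_inner)
  qed (simp add: linear_0[OF T])
  define u where "u = T v - c *\<^sub>R v"
  have vS: "v \<in> S" and vv: "inner v v = 1"
    using v by (auto simp: norm_eq_1)
  have uS: "u \<in> S" unfolding u_def using S inv vS by (intro subspace_diff subspace_scale)
  define K where "K = c * inner u u - inner u (T u)"
  \<comment> \<open>This is \<open>bound\<close> at \<open>v + t u\<close>: the constant term
    vanishes by the choice of \<open>c\<close>, and the linear coefficient is
    \<open>-2 <u, u>\<close>.\<close>
  have quad: "0 \<le> t * t * K - 2 * t * inner u u" for t
  proof -
    have "v + t *\<^sub>R u \<in> S" using S vS uS by (intro subspace_add subspace_scale)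
    from bound[OF this] have "0 \<le> c * inner v v - inner v (T v) +
        t * (2 * (c * inner u v) - inner v (T u) - inner u (T v)) + t * t * K"
      by (simp add: linear_add[OF T] linear_cmul[OF T] inner_simps K_def algebra_simps
          inner_commute[of v u])
    moreover have "inner v (T u) = inner u (T v)"
      by (metis adj inner_commute)
    moreover have "2 * t * inner u u = t * (2 * inner u (T v) - 2 * (c * inner u v))"
      by (subst (2) u_def) (simp add: inner_simps algebra_simps)
    ultimately show ?thesis by (simp add: vv c_def algebra_simps)
  qed
  have "inner u u = 0"
  proof (rule ccontr)
    assume "inner u u \<noteq> 0"
    then have a: "inner u u > 0" by simp
    \<comment> \<open>Small enough that the quadratic term is at most half of what
      \<open>quad\<close> demands.\<close>
    define t where "t = inner u u / (\<bar>K\<bar> + 1)"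
    have t: "t > 0" and tK: "t * (\<bar>K\<bar> + 1) = inner u u" using a by (simp_all add: t_def)
    have "0 \<le> t * (t * K - 2 * inner u u)" using quad[of t] by (simp add: algebra_simps)
    then have "2 * inner u u \<le> t * K" using t by (simp add: zero_le_mult_iff)
    also have "\<dots> \<le> t * (\<bar>K\<bar> + 1)" using t by (intro mult_left_mono) auto
    finally show False using tK a by simp
  qed
  then have "T v = c *\<^sub>R v" by (simp add: u_def)
  with vS vv that show ?thesis by force
qed

section \<open>Orthonormal eigenvectors of symplectic matrices\<close>

lemma qcis_simps [simp]: "qI (qcis t) = sin t" "qJ (qcis t) = 0" "qK (qcis t) = 0"
  by (simp_all add: qcis_def quat_of_complex_def)

lemma qcnj_qcis: "qcnj (qcis t) = qcis (- t)"
  by (simp add: quat_eq_iff)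

lemma qcis_mult_minus [simp]: "qcis t * qcis (- t) = 1" "qcis (- t) * qcis t = 1"
  by (simp_all add: quat_eq_iff flip: power2_eq_square)

lemma Sp_mult_vec_cancel:
  assumes "A \<in> carrier Sp"
  shows "A *v (conj_transpose A *v x) = x" "conj_transpose A *v (A *v x) = x"
  using assms by (simp_all add: carrier_Sp matrix_vector_mul_assoc)

lemma Sp_qinner: "A \<in> carrier Sp \<Longrightarrow> qinner (A *v x) (A *v y) = qinner x y"
  by (simp add: qinner_mult_vec Sp_mult_vec_cancel)

lemma Sp_norm: "A \<in> carrier Sp \<Longrightarrow> norm (A *v x) = norm x"
  by (simp add: norm_eq_sqrt_inner Sp_qinner flip: qRe_qinner)

text \<open>The operator \<open>A + A\<^sup>*\<close> is self-adjoint; on an eigenvector \<open>v\<close> with eigenvalue \<open>2 cos t\<close>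
  one has \<open>(A - e\<^sup>i\<^sup>t) (A - e\<^sup>-\<^sup>i\<^sup>t) v = 0\<close>, where scalars act from the right.\<close>

lemma Sp_eigenvector:
  fixes A :: "quat^'n^'n"
  assumes A: "A \<in> carrier Sp" and W: "subspace W" and inv: "\<And>x. x \<in> W \<Longrightarrow> A *v x \<in> W"
    "\<And>x. x \<in> W \<Longrightarrow> conj_transpose A *v x \<in> W" "\<And>x q. x \<in> W \<Longrightarrow> rscale x q \<in> W"
    and x0: "x0 \<in> W" "x0 \<noteq> 0"
  obtains v t where "v \<in> W" "v \<noteq> 0" "t \<in> {0..pi}" "A *v v = rscale v (qcis t)"
proof -
  define T where "T x = A *v x + conj_transpose A *v x" for x
  have adj: "inner x (T y) = inner (T x) y" for x y
  proof -
    have "qinner x (T y) = qinner (T x) y"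
      by (subst (2) qcnj_qinner[symmetric])
        (simp add: T_def qinner_add_right qcnj_add qcnj_qinner qinner_mult_vec)
    then show ?thesis by (metis qRe_qinner)
  qed
  have "linear T"
    unfolding T_def by (intro linear_compose_add linear_mult_vec)
  moreover have "T x \<in> W" if "x \<in> W" for x
    unfolding T_def using W inv that by (intro subspace_add) auto
  ultimately obtain v c where v: "v \<in> W" "v \<noteq> 0" and Tv: "T v = c *\<^sub>R v"
    using self_adjoint_eigenvector[of T W x0] adj W x0 by metis
  \<comment> \<open>\<open>A\<close> and its adjoint are isometries, so \<open>c / 2\<close> lies in
    [-1, 1] and is a cosine.\<close>
  have "\<bar>c\<bar> * norm v = norm (T v)" by (simp add: Tv)
  also have "\<dots> \<le> norm v + norm v"
    unfolding T_def by (rule order.trans[OF norm_triangle_ineq])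
      (simp add: Sp_norm A conj_transpose_in_Sp)
  finally have "\<bar>c\<bar> * norm v \<le> 2 * norm v" by simp
  then have c: "\<bar>c\<bar> \<le> 2" using v by simp
  define t where "t = arccos (c / 2)"
  have t: "t \<in> {0..pi}" and cos: "cos t = c / 2"
    using c by (auto simp: t_def arccos_lbound arccos_ubound cos_arccos)
  have AA: "A *v (A *v v) + v = c *\<^sub>R (A *v v)"
    using arg_cong[OF Tv, of "(*v) A"]
    by (simp add: T_def matrix_vector_right_distrib Sp_mult_vec_cancel[OF A] linear_cmul[OF linear_mult_vec])
  \<comment> \<open>One factor of the quadratic equation applied to \<open>v\<close>. If
    \<open>u\<close> is nonzero, it is an eigenvector for \<open>qcis t\<close>; if it is zero,
    \<open>v\<close> is one for \<open>qcis (- t)\<close>, and right multiplication by the unit j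
    turns that eigenvalue into \<open>qcis t\<close>.\<close>
  define u where "u = A *v v - rscale v (qcis (- t))"
  show ?thesis
  proof (cases "u = 0")
    case False
    have "rscale (A *v v) (qcis t) + rscale (A *v v) (qcis (- t)) = c *\<^sub>R (A *v v)"
      unfolding rscale_add_right[symmetric] by (simp add: vec_eq_iff quat_eq_iff cos)
    then have "A *v u = rscale u (qcis t)"
      using AA
      by (simp add: u_def linear_diff[OF linear_mult_vec] mult_vec_rscale vec_eq_iff algebra_simps)
    moreover have "u \<in> W" unfolding u_def using W v inv by (intro subspace_diff) auto
    ultimately show ?thesis using that t False by blast
  next
    case True
    let ?j = "Quat 0 0 1 0"
    have "A *v rscale v ?j = rscale v (qcis (- t) * ?j)"
      using True by (simp add: u_def mult_vec_rscale rscale_rscale)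
    also have "qcis (- t) * ?j = ?j * qcis t" by (simp add: quat_eq_iff)
    finally have "A *v rscale v ?j = rscale (rscale v ?j) (qcis t)" by (simp add: rscale_rscale)
    moreover have "rscale v ?j \<noteq> 0" using v by (auto simp: rscale_eq_0_iff quat_eq_iff)
    ultimately show ?thesis using that t v inv by blast
  qed
qed

text \<open>The right multiples of the \<open>b s\<close> span a real space of dimension at most 4
  \<open>card S\<close>, less than 4n, so some nonzero \<open>x\<close> is real-orthogonal to it.
  The real products of \<open>x\<close> with \<open>rscale (b s) q\<close>, for basis elements
  \<open>q\<close>, are the four components of \<open>qinner (b s) x\<close>.\<close>

lemma qinner_complement_nontrivial:
  fixes b :: "'n::finite \<Rightarrow> quat^'n"
  assumes "S \<noteq> UNIV"
  obtains x where "x \<noteq> 0" "\<And>s. s \<in> S \<Longrightarrow> qinner (b s) x = 0"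
proof -
  let ?B = "(\<lambda>(s, q). rscale (b s) q) ` (S \<times> Basis)"
  have "card S < CARD('n)" using assms by (simp add: psubset_card_mono psubsetI)
  moreover have "dim ?B \<le> card ?B" by (intro dim_le_card') simp
  moreover have "card ?B \<le> card S * 4"
    by (rule order.trans[OF card_image_le]) (simp_all add: card_cartesian_product)
  ultimately have "dim ?B < DIM(quat^'n)" by simp
  then obtain x where x: "x \<noteq> 0" "\<And>y. y \<in> span ?B \<Longrightarrow> orthogonal x y"
    using orthogonal_to_subspace_exists by blast
  have "qinner (b s) x = 0" if "s \<in> S" for s
  proof (rule euclidean_eqI)
    fix q :: quat assume q: "q \<in> Basis"
    then have "rscale (b s) q \<in> ?B" using that by force
    then have "inner (rscale (b s) q) x = 0"
      using x(2)[OF span_base] by (metis orthogonal_def inner_commute)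
    then have "inner q (qinner (b s) x) = 0"
      by (simp add: qinner_rscale_left inner_quat_eq flip: qRe_qinner)
    then show "inner (qinner (b s) x) q = inner 0 q" by (simp add: inner_commute)
  qed
  with x that show ?thesis by blast
qed

text \<open>Induction on the index set: the complement \<open>W\<close> of the vectors found so far
  is nonzero and stable under \<open>A\<close>, its adjoint and right scalars, so it contains a
  further eigenvector.\<close>

lemma Sp_orthonormal_eigenvectors:
  fixes A :: "quat^'n^'n" and S :: "'n set"
  assumes A: "A \<in> carrier Sp"
  shows "\<exists>b \<theta>. (\<forall>s\<in>S. \<theta> s \<in> {0..pi} \<and> A *v b s = rscale (b s) (qcis (\<theta> s))) \<and>
    (\<forall>s\<in>S. \<forall>t\<in>S. qinner (b s) (b t) = (if s = t then 1 else 0))"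
  using finite[of S]
proof (induction S rule: finite_induct)
  case (insert r S)
  obtain b \<theta> where b\<theta>: "(\<forall>s\<in>S. \<theta> s \<in> {0..pi} \<and> A *v b s = rscale (b s) (qcis (\<theta> s))) \<and>
    (\<forall>s\<in>S. \<forall>t\<in>S. qinner (b s) (b t) = (if s = t then 1 else 0))"
    using insert.IH by (elim exE) (rule that)
  then have ev: "\<theta> s \<in> {0..pi} \<and> A *v b s = rscale (b s) (qcis (\<theta> s))" if "s \<in> S" for s
    using that by (elim conjE) (rule bspec)
  have on: "qinner (b s) (b t) = (if s = t then 1 else 0)" if "s \<in> S" "t \<in> S" for s t
    using b\<theta> that by (elim conjE) (drule bspec, assumption, erule bspec)
  define W where "W = {x. \<forall>s\<in>S. qinner (b s) x = 0}"
  have "S \<noteq> UNIV" using insert by auto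
  then obtain x0 where "x0 \<noteq> 0" and x0: "\<And>s. s \<in> S \<Longrightarrow> qinner (b s) x0 = 0"
    by (rule qinner_complement_nontrivial[of S b]) (rule that, assumption, blast)
  moreover from x0 have "x0 \<in> W" by (simp add: W_def)
  moreover have "subspace W"
    by (simp add: W_def subspace_def qinner_add_right qinner_scaleR_right)
  moreover have "A *v x \<in> W" if "x \<in> W" for x
  proof -
    have "qinner (b s) (A *v x) = 0" if "s \<in> S" for s
    proof -
      \<comment> \<open>\<open>b s\<close> is the image of a right multiple of itself, so invariance
        of the form under \<open>A\<close> keeps \<open>A *v x\<close> orthogonal to it.\<close>
      have "b s = A *v rscale (b s) (qcis (- \<theta> s))"
        using ev[OF that] by (simp add: mult_vec_rscale rscale_rscale) (simp add: vec_eq_iff)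
      then have "qinner (b s) (A *v x) = qinner (rscale (b s) (qcis (- \<theta> s))) x"
        by (metis Sp_qinner[OF A])
      then show ?thesis using \<open>x \<in> W\<close> that by (simp add: W_def qinner_rscale_left)
    qed
    then show ?thesis by (simp add: W_def)
  qed
  moreover have "conj_transpose A *v x \<in> W" if "x \<in> W" for x
    using that by (simp add: W_def ev qinner_rscale_left flip: qinner_mult_vec)
  moreover have "rscale x q \<in> W" if "x \<in> W" for x q
    using that by (simp add: W_def qinner_rscale_right)
  ultimately obtain v t where v: "v \<in> W" "v \<noteq> 0" "t \<in> {0..pi}" "A *v v = rscale v (qcis t)"
    using Sp_eigenvector[OF A, of W x0] by blast
  define u where "u = (1 / norm v) *\<^sub>R v"
  have "u \<in> W" unfolding u_def using v \<open>subspace W\<close> by (simp add: subspace_scale)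
  then have u1: "qinner (b s) u = 0" if "s \<in> S" for s
    using that by (simp add: W_def)
  then have u2: "qinner u (b s) = 0" if "s \<in> S" for s
    using that by (metis qcnj_qinner qcnj_0)
  have u3: "qinner u u = 1"
    unfolding qinner_self using v by (simp add: u_def power2_eq_square flip: power2_norm_eq_inner)
  have u4: "A *v u = rscale u (qcis t)"
    using v by (simp add: u_def linear_cmul[OF linear_mult_vec] vec_eq_iff)
  show ?case
    using ev on u1 u2 u3 u4 v insert(2)
    by (intro exI[of _ "b(r := u)"] exI[of _ "\<theta>(r := t)"]) auto
qed simp

text \<open>A left inverse makes \<open>V\<close> injective; as a real-linear endomorphism of a
  finite-dimensional space it is then surjective.\<close>

lemma quat_matrix_left_inverse:
  fixes V :: "quat^'n^'n"
  assumes "W ** V = mat 1"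
  shows "V ** W = mat 1"
proof -
  have WV: "W *v (V *v x) = x" for x by (simp add: matrix_vector_mul_assoc assms)
  then have "inj ((*v) V)" by (metis injI)
  then have "surj ((*v) V)" by (intro linear_inj_imp_surj linear_mult_vec)
  then have "(V ** W) *v y = y" for y
    by (metis WV matrix_vector_mul_assoc surjD)
  then show ?thesis by (metis matrix_eq matrix_vector_mul_lid)
qed

lemma Sp_mult: "U \<otimes>\<^bsub>Sp\<^esub> V = U ** V" and Sp_one: "\<one>\<^bsub>Sp\<^esub> = mat 1"
  by (simp_all add: Sp_def)

lemma Sp_inv:
  assumes "U \<in> carrier (Sp :: (quat^'n^'n) monoid)"
  shows "inv\<^bsub>Sp\<^esub> U = conj_transpose U"
proof -
  interpret Sp: group "Sp :: (quat^'n^'n) monoid" by (rule group_Sp)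
  show ?thesis
    using assms conj_transpose_in_Sp[OF assms]
    by (intro Sp.inv_equality) (simp_all add: Sp_def)
qed

theorem Sp_diagonalisable:
  fixes A :: "quat^'n^'n"
  assumes A: "A \<in> carrier Sp"
  obtains \<theta> where "diagonal_angles A \<theta>"
proof -
  obtain b \<theta> where b\<theta>: "(\<forall>s\<in>(UNIV :: 'n set). \<theta> s \<in> {0..pi} \<and> A *v b s = rscale (b s) (qcis (\<theta> s))) \<and>
    (\<forall>s\<in>(UNIV :: 'n set). \<forall>t\<in>UNIV. qinner (b s) (b t) = (if s = t then 1 else 0))"
    using Sp_orthonormal_eigenvectors[OF A, of UNIV] by (elim exE) (rule that)
  then have ev: "\<theta> s \<in> {0..pi}" "A *v b s = rscale (b s) (qcis (\<theta> s))" for s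
    by simp_all
  from b\<theta> have on: "qinner (b s) (b t) = (if s = t then 1 else 0)" for s t
    by simp
  \<comment> \<open>The columns are the eigenvectors: orthonormality becomes \<open>V1\<close>, the
    eigenvalue equations become \<open>A ** V = V ** D\<close> with \<open>D\<close> diagonal, and
    the adjoint of \<open>V\<close> is the conjugating element.\<close>
  define V where "V = (\<chi> i s. b s $ i)"
  have V1: "conj_transpose V ** V = mat 1"
    using on by (simp add: vec_eq_iff V_def conj_transpose_def matrix_matrix_mult_def mat_def qinner_def)
  then have V: "conj_transpose V \<in> carrier Sp"
    using quat_matrix_left_inverse[OF V1] by (simp add: carrier_Sp)
  have "(A ** V) $ i $ s = (V ** qdiag (\<lambda>s. qcis (\<theta> s))) $ i $ s" for i s
  proof -
    have "(A ** V) $ i $ s = (A *v b s) $ i"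
      by (simp add: matrix_matrix_mult_def matrix_vector_mult_def V_def)
    then show ?thesis by (simp add: ev mult_qdiag V_def)
  qed
  then have "A ** V = V ** qdiag (\<lambda>s. qcis (\<theta> s))" by (simp add: vec_eq_iff)
  then have "conj_transpose V ** A ** V = qdiag (\<lambda>s. qcis (\<theta> s))"
    by (simp add: V1 matrix_mul_assoc flip: matrix_mul_assoc[of _ A V])
  then have "diagonal_angles A \<theta>"
    unfolding diagonal_angles_def using ev V
    by (intro conjI allI bexI[of _ "conj_transpose V"]) (simp_all add: Sp_mult Sp_inv)
  with that show ?thesis .
qed

section \<open>Strong reversibility\<close>

lemma (in group) strongly_reversible_iff:
  assumes g: "g \<in> carrier G"
  shows "strongly_reversible G g \<longleftrightarrow> (\<exists>h\<in>carrier G. h \<otimes> h = \<one> \<and> h \<otimes> g = inv g \<otimes> h)"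
proof -
  have "h [^] (2::nat) = h \<otimes> h" if "h \<in> carrier G" for h
    using that by (simp add: numeral_2_eq_2)
  moreover have "h \<otimes> g \<otimes> inv h = inv g \<longleftrightarrow> h \<otimes> g = inv g \<otimes> h" if "h \<in> carrier G" for h
    using that g by (metis inv_closed inv_solve_right m_closed)
  ultimately show ?thesis by (auto simp: strongly_reversible_def)
qed

lemma (in group) strongly_reversible_conj:
  assumes g: "g \<in> carrier G" and k: "k \<in> carrier G" and rev: "strongly_reversible G g"
  shows "strongly_reversible G (k \<otimes> g \<otimes> inv k)"
proof -
  obtain h where h: "h \<in> carrier G" and hh: "h \<otimes> h = \<one>" and hg: "h \<otimes> g = inv g \<otimes> h"
    using rev strongly_reversible_iff[OF g] by blast
  have cancel: "(k \<otimes> x \<otimes> inv k) \<otimes> (k \<otimes> y \<otimes> inv k) = k \<otimes> (x \<otimes> y) \<otimes> inv k"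
    if "x \<in> carrier G" "y \<in> carrier G" for x y
    using that k by (simp add: m_assoc inv_solve_left')
  have "inv (k \<otimes> g \<otimes> inv k) = k \<otimes> inv g \<otimes> inv k"
    using g k by (simp add: inv_mult_group m_assoc)
  then show ?thesis
    using g k h by (subst strongly_reversible_iff)
      (auto intro!: bexI[of _ "k \<otimes> h \<otimes> inv k"] simp: cancel hh hg)
qed

lemma Sp_strongly_reversible_iff:
  fixes A :: "quat^'n^'n"
  assumes A: "A \<in> carrier Sp"
  shows "strongly_reversible Sp A \<longleftrightarrow>
    (\<exists>H\<in>carrier Sp. H ** H = mat 1 \<and> H ** A = conj_transpose A ** H)"
proof -
  interpret Sp: group "Sp :: (quat^'n^'n) monoid" by (rule group_Sp)
  show ?thesis
    using A by (simp add: Sp.strongly_reversible_iff Sp_mult Sp_one Sp_inv)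
qed

section \<open>The affine group in terms of linear and translation parts\<close>

lemma Sp_affine_carrier: "(A, w) \<in> carrier Sp_affine \<longleftrightarrow> A \<in> carrier Sp"
  and Sp_affine_mult: "(A, v) \<otimes>\<^bsub>Sp_affine\<^esub> (B, w) = (A ** B, A *v w + v)"
  and Sp_affine_one: "\<one>\<^bsub>Sp_affine\<^esub> = (mat 1, 0)"
  by (simp_all add: Sp_affine_def)

lemma Sp_affine_inv:
  fixes A :: "quat^'n^'n"
  assumes A: "A \<in> carrier Sp"
  shows "inv\<^bsub>Sp_affine\<^esub> (A, w) = (conj_transpose A, - (conj_transpose A *v w))"
proof -
  interpret G: group "Sp_affine :: ((quat^'n^'n) \<times> (quat^'n)) monoid" by (rule group_Sp_affine)
  show ?thesis
    using A conj_transpose_in_Sp[OF A]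
    by (intro G.inv_equality) (simp_all add: Sp_affine_carrier Sp_affine_mult Sp_affine_one carrier_Sp)
qed

text \<open>The equations are the linear and translation parts of \<open>h h = 1\<close> and
  \<open>h g = g^-1 h\<close> for \<open>h = (H, u)\<close>. The linear ones alone express strong
  reversibility of \<open>A\<close> in \<open>Sp\<close>.\<close>

lemma Sp_affine_strongly_reversible_iff:
  fixes A :: "quat^'n^'n"
  assumes A: "A \<in> carrier Sp"
  shows "strongly_reversible Sp_affine (A, w) \<longleftrightarrow>
    (\<exists>H\<in>carrier Sp. \<exists>u. H ** H = mat 1 \<and> H *v u + u = 0 \<and> H ** A = conj_transpose A ** H \<and>
       H *v w + u = conj_transpose A *v u - conj_transpose A *v w)"
proof -
  interpret G: group "Sp_affine :: ((quat^'n^'n) \<times> (quat^'n)) monoid" by (rule group_Sp_affine)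
  have "(A, w) \<in> carrier Sp_affine" using A by (simp add: Sp_affine_carrier)
  then show ?thesis
    by (simp add: G.strongly_reversible_iff Bex_def split_paired_Ex Sp_affine_carrier
      Sp_affine_mult Sp_affine_one Sp_affine_inv[OF A])
qed

section \<open>Eigenvalue classes and angles\<close>

lemma qcis_0 [simp]: "qcis 0 = 1" and qcis_pi [simp]: "qcis pi = - 1"
  by (simp_all add: quat_eq_iff)

lemma similarity_class_conj:
  assumes \<mu>: "\<mu> \<noteq> 0"
  shows "similarity_class (inverse \<mu> * \<alpha> * \<mu>) = similarity_class \<alpha>"
proof -
  \<comment> \<open>Proved for all parameters, so that applying it to \<open>inverse \<mu>\<close>
    gives the reverse inclusion.\<close>
  have sub: "similarity_class (inverse \<mu> * \<alpha> * \<mu>) \<subseteq> similarity_class \<alpha>" if "\<mu> \<noteq> 0" for \<mu> \<alpha>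
  proof
    fix x assume "x \<in> similarity_class (inverse \<mu> * \<alpha> * \<mu>)"
    then obtain \<nu> where "\<nu> \<noteq> 0" "x = inverse \<nu> * (inverse \<mu> * \<alpha> * \<mu>) * \<nu>"
      by (auto simp: similarity_class_def)
    then have "x = inverse (\<mu> * \<nu>) * \<alpha> * (\<mu> * \<nu>)" "\<mu> * \<nu> \<noteq> 0"
      using that by (simp_all add: nonzero_inverse_mult_distrib mult.assoc)
    then show "x \<in> similarity_class \<alpha>" unfolding similarity_class_def by blast
  qed
  have "inverse (inverse \<mu>) * (inverse \<mu> * \<alpha> * \<mu>) * inverse \<mu> = \<alpha>"
    using \<mu> by (simp add: mult.assoc) (simp flip: mult.assoc)
  then have "similarity_class \<alpha> \<subseteq> similarity_class (inverse \<mu> * \<alpha> * \<mu>)"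
    using sub[of "inverse \<mu>" "inverse \<mu> * \<alpha> * \<mu>"] \<mu> by simp
  with sub[OF \<mu>] show ?thesis by blast
qed

lemma diagonal_angles_obtain:
  fixes A :: "quat^'n^'n"
  assumes "diagonal_angles A \<theta>"
  obtains U where "U \<in> carrier Sp" "U ** A ** conj_transpose U = qdiag (\<lambda>s. qcis (\<theta> s))"
  using assms unfolding diagonal_angles_def by (auto simp: Sp_mult Sp_inv)

lemma qdiag_mult_vec: "qdiag d *v x = (\<chi> s. d s * x $ s)"
  by (simp add: vec_eq_iff matrix_vector_mult_def qdiag_def if_distrib if_distribR cong: if_cong)

text \<open>In diagonal coordinates the eigenvector equation splits into one equation per
  coordinate, and any nonzero coordinate conjugates its diagonal entry to the eigenvalue.\<close>

lemma eigenvalue_classes_eq: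
  fixes A :: "quat^'n^'n"
  assumes \<theta>: "diagonal_angles A \<theta>"
  shows "eigenvalue_classes A = range (\<lambda>s. similarity_class (qcis (\<theta> s)))"
proof -
  obtain U where U: "U \<in> carrier Sp" and D: "U ** A ** conj_transpose U = qdiag (\<lambda>s. qcis (\<theta> s))"
    using diagonal_angles_obtain[OF \<theta>] by blast
  have UA: "U *v (A *v x) = qdiag (\<lambda>s. qcis (\<theta> s)) *v (U *v x)" for x
    unfolding D[symmetric] by (simp add: Sp_mult_vec_cancel[OF U] flip: matrix_vector_mul_assoc)
  have U_eq: "x = y" if "U *v x = U *v y" for x y
    using that Sp_mult_vec_cancel(2)[OF U] by metis
  have ev: "right_eigenvalue A \<alpha> \<longleftrightarrow> (\<exists>s \<mu>. \<mu> \<noteq> 0 \<and> \<alpha> = inverse \<mu> * qcis (\<theta> s) * \<mu>)" for \<alpha>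
  proof
    assume "right_eigenvalue A \<alpha>"
    then obtain v where "v \<noteq> 0" and v: "A *v v = rscale v \<alpha>"
      by (auto simp: right_eigenvalue_def rscale_def)
    then have "U *v v \<noteq> 0" using U_eq[of v 0] by auto
    then obtain s where s: "(U *v v) $ s \<noteq> 0" by (auto simp: vec_eq_iff)
    have "qcis (\<theta> s) * (U *v v) $ s = (U *v v) $ s * \<alpha>"
      using UA[of v] by (simp add: v mult_vec_rscale qdiag_mult_vec vec_eq_iff)
    then have "\<alpha> = inverse ((U *v v) $ s) * qcis (\<theta> s) * (U *v v) $ s"
      using s by (simp add: mult.assoc) (simp flip: mult.assoc)
    with s show "\<exists>s \<mu>. \<mu> \<noteq> 0 \<and> \<alpha> = inverse \<mu> * qcis (\<theta> s) * \<mu>" by blast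
  next
    assume "\<exists>s \<mu>. \<mu> \<noteq> 0 \<and> \<alpha> = inverse \<mu> * qcis (\<theta> s) * \<mu>"
    then obtain s \<mu> where \<mu>: "\<mu> \<noteq> 0" and \<alpha>: "\<alpha> = inverse \<mu> * qcis (\<theta> s) * \<mu>" by blast
    \<comment> \<open>In diagonal coordinates this is a multiple of one basis vector; the entry
      \<open>\<mu>\<close> realises the conjugate by \<open>\<mu>\<close> of the diagonal
      entry.\<close>
    define v where "v = conj_transpose U *v axis s \<mu>"
    have Uv: "U *v v = axis s \<mu>" by (simp add: v_def Sp_mult_vec_cancel[OF U])
    have "U *v (A *v v) = U *v rscale v \<alpha>"
      unfolding UA mult_vec_rscale Uv using \<mu>
      by (simp add: vec_eq_iff qdiag_mult_vec axis_def \<alpha> mult.assoc) (simp flip: mult.assoc)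
    then have "A *v v = rscale v \<alpha>" by (rule U_eq)
    moreover have "v \<noteq> 0" using Uv \<mu> by (auto simp: axis_eq_0_iff)
    ultimately show "right_eigenvalue A \<alpha>"
      by (auto simp: right_eigenvalue_def rscale_def)
  qed
  have "right_eigenvalue A (qcis (\<theta> s))" for s
    unfolding ev by (intro exI[of _ s] exI[of _ 1]) simp
  moreover have "similarity_class \<alpha> \<in> range (\<lambda>s. similarity_class (qcis (\<theta> s)))"
    if "right_eigenvalue A \<alpha>" for \<alpha>
    using that by (auto simp: ev similarity_class_conj)
  ultimately show ?thesis
    by (auto simp: eigenvalue_classes_def)
qed

text \<open>An angle in [0, pi] is determined by its similarity class, so the classes of 1 and -1
  correspond exactly to the angles 0 and pi.\<close>

lemma even_multiplicities_iff:
  fixes A :: "quat^'n^'n"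
  assumes \<theta>: "diagonal_angles A \<theta>"
  shows "(\<forall>C\<in>eigenvalue_classes A.
      C = similarity_class 1 \<or> C = similarity_class (- 1) \<or> even (class_multiplicity A C))
    \<longleftrightarrow> (\<forall>s. \<theta> s = 0 \<or> \<theta> s = pi \<or> even (card {r. \<theta> r = \<theta> s}))"
proof -
  have angle: "class_angle (similarity_class (qcis (\<theta> s))) = \<theta> s" for s
    using \<theta> by (intro class_angle_similarity_class) (simp add: diagonal_angles_def)
  have "similarity_class (qcis (\<theta> s)) = similarity_class 1 \<longleftrightarrow> \<theta> s = 0" for s
    using angle[of s] class_angle_similarity_class[of 0] by auto
  moreover have "similarity_class (qcis (\<theta> s)) = similarity_class (- 1) \<longleftrightarrow> \<theta> s = pi" for s
    using angle[of s] class_angle_similarity_class[of pi] by auto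
  ultimately show ?thesis
    by (simp add: eigenvalue_classes_eq[OF \<theta>] class_multiplicity_eq[OF \<theta>] angle)
qed

section \<open>Involutions reversing a diagonal matrix\<close>

text \<open>On the block of an angle \<open>t\<close> with \<open>0 < t < \<pi>\<close> a reversing matrix has the form \<open>C j\<close> with
  \<open>C\<close> complex, and it is an involution iff \<open>C \<cdot> cnj C = - 1\<close>, so that
  \<open>\<bar>det C\<bar>\<^sup>2 = (- 1)\<^sup>m\<close> for the size \<open>m\<close> of the block.\<close>

lemma even_card_of_reversing_involution:
  fixes H :: "quat^'n^'n"
  assumes HH: "H ** H = mat 1"
    and rev: "H ** qdiag (\<lambda>s. qcis (\<theta> s)) = qdiag (\<lambda>s. qcis (- \<theta> s)) ** H"
    and \<theta>: "\<And>s. \<theta> s \<in> {0..pi}" and t: "0 < t" "t < pi"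
  shows "even (card {s. \<theta> s = t})"
proof -
  let ?S = "{s. \<theta> s = t}"
  have comm: "H $ i $ j * qcis (\<theta> j) = qcis (- \<theta> i) * H $ i $ j" for i j
    by (metis rev qdiag_mult mult_qdiag)
  \<comment> \<open>A nonzero entry would make \<open>qcis (\<theta> j)\<close> and
    \<open>qcis (- \<theta> i)\<close> similar; equal real parts then force equal angles.\<close>
  have block: "H $ i $ j = 0" if "i \<in> ?S" "j \<notin> ?S" for i j
  proof (rule ccontr)
    assume nz: "H $ i $ j \<noteq> 0"
    have "qcis (\<theta> j) = inverse (H $ i $ j) * (H $ i $ j * qcis (\<theta> j))"
      using nz by (simp flip: mult.assoc)
    also have "\<dots> = inverse (H $ i $ j) * qcis (- \<theta> i) * H $ i $ j"
      by (simp add: comm mult.assoc)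
    finally have "cos (\<theta> j) = cos (\<theta> i)" using nz by (metis qRe_similar qRe_qcis cos_minus)
    then show False
      using that \<theta> cos_inj_pi by (metis (mono_tags) atLeastAtMost_iff mem_Collect_eq)
  qed
  \<comment> \<open>The commutation relation multiplies the complex part of an entry by 2 i sin t
    and requires the result to vanish, so only the j and k parts survive.\<close>
  have "sin t \<noteq> 0" using t sin_gt_zero by force
  have jk: "qRe (H $ i $ j) = 0" "qI (H $ i $ j) = 0" if "i \<in> ?S" "j \<in> ?S" for i j
    using comm[of i j] that \<open>sin t \<noteq> 0\<close> by (auto simp: quat_eq_iff)
  define C where "C i j = Complex (qJ (H $ i $ j)) (qK (H $ i $ j))" for i j
  \<comment> \<open>The block is padded with the identity, so that its determinant is that of a
    matrix over the full index type.\<close>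
  define M :: "complex^'n^'n" where
    "M = (\<chi> i j. if i \<in> ?S then if j \<in> ?S then C i j else 0 else if i = j then 1 else 0)"
  define M' :: "complex^'n^'n" where "M' = (\<chi> i j. cnj (M $ i $ j))"
  define p where "p q = Complex (qRe q) (qI q)" for q
  have p_sum: "p (sum f X) = (\<Sum>x\<in>X. p (f x))" for f :: "'n \<Rightarrow> quat" and X
    by (induction X rule: infinite_finite_induct) (simp_all add: p_def complex_eq_iff)
  have MM: "(M ** M') $ i $ j = (if i = j then if i \<in> ?S then - 1 else 1 else 0)" for i j
  proof (cases "i \<in> ?S")
    case i: True
    have "(M ** M') $ i $ j = (\<Sum>k\<in>?S. C i k * cnj (M $ k $ j))"
      by (simp add: matrix_matrix_mult_def M'_def)
        (rule sum.mono_neutral_cong_right; use i in \<open>simp add: M_def\<close>)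
    also have "\<dots> = (if i = j then - 1 else 0)"
    proof (cases "j \<in> ?S")
      case j: True
      \<comment> \<open>For complex c and d, (c j) (d j) = - c cnj(d), because j d = cnj(d) j and
        j^2 = -1.\<close>
      have "p (H $ i $ k * H $ k $ j) = - (C i k * cnj (C k j))" if "k \<in> ?S" for k
        using jk[OF i that] jk[OF that j] by (simp add: p_def C_def complex_eq_iff)
      then have "(\<Sum>k\<in>?S. C i k * cnj (M $ k $ j)) = - (\<Sum>k\<in>?S. p (H $ i $ k * H $ k $ j))"
        using j by (simp add: M_def sum_negf)
      also have "(\<Sum>k\<in>?S. p (H $ i $ k * H $ k $ j)) = (\<Sum>k\<in>UNIV. p (H $ i $ k * H $ k $ j))"
        using block[OF i] by (intro sum.mono_neutral_left) (auto simp: p_def complex_eq_iff)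
      also have "\<dots> = p ((H ** H) $ i $ j)"
        by (simp add: matrix_matrix_mult_def p_sum)
      finally show ?thesis by (simp add: HH mat_def p_def complex_eq_iff)
    next
      case False
      then show ?thesis using i by (auto simp: M_def)
    qed
    finally show ?thesis using i by auto
  next
    case i: False
    have "(M ** M') $ i $ j = (\<Sum>k\<in>UNIV. if i = k then cnj (M $ k $ j) else 0)"
      unfolding matrix_matrix_mult_def M'_def vec_lambda_beta
      by (rule sum.cong; use i in \<open>simp add: M_def\<close>)
    then show ?thesis using i by (auto simp: M_def)
  qed
  have "det M' = cnj (det M)"
    by (simp add: det_def M'_def cnj_sum cnj_prod)
  then have "det (M ** M') = complex_of_real ((cmod (det M))\<^sup>2)"
    by (simp add: det_mul complex_norm_square del: of_real_power)
  moreover have "det (M ** M') = (\<Prod>i\<in>UNIV. if i \<in> ?S then - 1 else 1)"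
    by (subst det_diagonal) (simp_all add: MM)
  moreover have "\<dots> = (- 1) ^ card ?S"
    by (simp add: prod.If_cases)
  ultimately have "complex_of_real ((cmod (det M))\<^sup>2) = complex_of_real ((- 1) ^ card ?S)"
    by simp
  then have "(cmod (det M))\<^sup>2 = (- 1) ^ card ?S" by (simp only: of_real_eq_iff)
  then have "(- 1 :: real) ^ card ?S \<ge> 0" by (metis zero_le_power2)
  then show ?thesis by (cases "even (card ?S)") auto
qed

section \<open>Construction of a reversing involution from even blocks\<close>

lemma even_card_pairing:
  assumes "finite S" "even (card S)"
  obtains \<sigma> :: "'a \<Rightarrow> 'a" and \<epsilon> :: "'a \<Rightarrow> real"
  where "\<And>s. s \<in> S \<Longrightarrow> \<sigma> s \<in> S \<and> \<sigma> (\<sigma> s) = s \<and> \<epsilon> s * \<epsilon> s = 1 \<and> \<epsilon> (\<sigma> s) = - \<epsilon> s"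
proof -
  obtain f where f: "bij_betw f {0..<card S} S"
    using ex_bij_betw_nat_finite[OF assms(1)] by blast
  define g where "g = inv_into {0..<card S} f"
  have g: "g s < card S" "f (g s) = s" if "s \<in> S" for s
    using bij_betw_inv_into[OF f] that bij_betw_inv_into_right[OF f that]
    by (auto simp: g_def bij_betw_def)
  have gf: "f n \<in> S" "g (f n) = n" if "n < card S" for n
    using that f bij_betw_inv_into_left[OF f] by (auto simp: g_def bij_betw_def)
  \<comment> \<open>Swaps 2k and 2k + 1. Evenness of \<open>card S\<close> ensures that an even
    index below it has its successor below it as well; the parity of the index serves as the
    sign.\<close>
  define p :: "nat \<Rightarrow> nat" where "p n = (if even n then n + 1 else n - 1)" for n
  have p: "p n < card S" if "n < card S" for n
    using that assms(2) by (auto simp: p_def) (metis Suc_lessI even_Suc)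
  have pp: "p (p n) = n" "even (p n) \<longleftrightarrow> odd n" for n
    by (auto simp: p_def)
  define \<epsilon> :: "'a \<Rightarrow> real" where "\<epsilon> s = (if even (g s) then 1 else - 1)" for s
  show ?thesis
    by (rule that[of "\<lambda>s. f (p (g s))" \<epsilon>]) (simp add: g gf p pp \<epsilon>_def)
qed

text \<open>Data for one block of a monomial matrix whose row \<open>s\<close> has the single entry
  \<open>h s\<close>, in column \<open>\<tau> s\<close>: the conditions say that it is an
  involution, Hermitian and reversing. For the angles 0 and pi the block is minus the
  identity.\<close>

lemma reversing_pairing:
  assumes S: "finite S" and "t = 0 \<or> t = pi \<or> even (card S)"
  shows "\<exists>\<tau> h. \<forall>s\<in>S. \<tau> s \<in> S \<and> \<tau> (\<tau> s) = s \<and> h s * h (\<tau> s) = 1 \<and> qcnj (h (\<tau> s)) = h s \<and>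
    h s * qcis t = qcis (- t) * h s \<and> (t = 0 \<longrightarrow> \<tau> s = s \<and> h s = - 1)"
proof (cases "t = 0 \<or> t = pi")
  case True
  then show ?thesis
    by (intro exI[of _ "\<lambda>s. s"] exI[of _ "\<lambda>s. - 1"]) (auto simp: quat_eq_iff)
next
  case False
  then obtain \<sigma> :: "'a \<Rightarrow> 'a" and \<epsilon> :: "'a \<Rightarrow> real"
    where "\<And>s. s \<in> S \<Longrightarrow> \<sigma> s \<in> S \<and> \<sigma> (\<sigma> s) = s \<and> \<epsilon> s * \<epsilon> s = 1 \<and> \<epsilon> (\<sigma> s) = - \<epsilon> s"
    using even_card_pairing[OF S] assms(2) by blast
  then show ?thesis
    \<comment> \<open>Opposite signs on a pair are forced: j (-j) = 1, while the conjugate of -j is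
      j. Both anticommute with i, which inverts \<open>qcis t\<close>.\<close>
    using False by (intro exI[of _ \<sigma>] exI[of _ "\<lambda>s. Quat 0 0 (\<epsilon> s) 0"]) (simp add: quat_eq_iff)
qed

text \<open>The block data are glued into one monomial matrix. Its last property, negation of
  vectors supported on the angle 0, serves to reverse the translation part.\<close>

lemma reversing_involution_exists:
  fixes \<theta> :: "'n::finite \<Rightarrow> real"
  assumes "\<And>s. \<theta> s = 0 \<or> \<theta> s = pi \<or> even (card {r. \<theta> r = \<theta> s})"
  obtains H :: "quat^'n^'n" where "H \<in> carrier Sp" "H ** H = mat 1"
    "H ** qdiag (\<lambda>s. qcis (\<theta> s)) = qdiag (\<lambda>s. qcis (- \<theta> s)) ** H"
    "\<And>x. (\<And>s. \<theta> s \<noteq> 0 \<Longrightarrow> x $ s = 0) \<Longrightarrow> H *v x = - x"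
proof -
  have "\<forall>s. \<exists>\<tau> h. \<forall>r\<in>{r. \<theta> r = \<theta> s}. \<tau> r \<in> {r. \<theta> r = \<theta> s} \<and> \<tau> (\<tau> r) = r \<and>
    h r * h (\<tau> r) = 1 \<and> qcnj (h (\<tau> r)) = h r \<and>
    h r * qcis (\<theta> s) = qcis (- \<theta> s) * h r \<and> (\<theta> s = 0 \<longrightarrow> \<tau> r = r \<and> h r = - 1)"
    using assms by (intro allI reversing_pairing) auto
  \<comment> \<open>The choice is indexed by the angle and not by the index, so that
    \<open>s\<close> and its partner use the same pairing.\<close>
  moreover define P where "P t \<tau> h \<longleftrightarrow> (\<forall>r. \<theta> r = t \<longrightarrow> \<theta> (\<tau> r) = t \<and> \<tau> (\<tau> r) = r \<and>
    h r * h (\<tau> r) = 1 \<and> qcnj (h (\<tau> r)) = h r \<and>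
    h r * qcis t = qcis (- t) * h r \<and> (t = 0 \<longrightarrow> \<tau> r = r \<and> h r = - 1))" for t \<tau> h
  ultimately have "\<forall>t\<in>range \<theta>. \<exists>\<tau> h. P t \<tau> h" by simp
  then obtain T K where TK: "\<And>s. P (\<theta> s) (T (\<theta> s)) (K (\<theta> s))"
    by (metis rangeI)
  define \<tau> where "\<tau> s = T (\<theta> s) s" for s
  define h where "h s = K (\<theta> s) s" for s
  have \<theta>\<tau>: "\<theta> (\<tau> s) = \<theta> s" for s
    using TK[of s] by (simp add: P_def \<tau>_def)
  have \<tau>: "\<tau> (\<tau> s) = s" for s
    using TK[of s] by (simp add: P_def \<tau>_def[of "\<tau> s"] \<theta>\<tau>) (simp add: \<tau>_def)
  have h: "h s * h (\<tau> s) = 1" "qcnj (h (\<tau> s)) = h s" for s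
    using TK[of s] by (simp_all add: P_def h_def[of "\<tau> s"] \<theta>\<tau>) (simp_all add: \<tau>_def h_def)
  have hq: "h s * qcis (\<theta> s) = qcis (- \<theta> s) * h s" for s
    using TK[of s] by (simp only: P_def h_def)
  have h0: "\<tau> s = s" "h s = - 1" if "\<theta> s = 0" for s
    using TK[of s] that by (simp_all add: P_def h_def \<tau>_def)
  define H :: "quat^'n^'n" where "H = (\<chi> s r. if r = \<tau> s then h s else 0)"
  have H_row: "(\<Sum>k\<in>UNIV. H $ s $ k * f k) = h s * f (\<tau> s)" for s f
  proof -
    have "(\<Sum>k\<in>UNIV. H $ s $ k * f k) = (\<Sum>k\<in>UNIV. if k = \<tau> s then h s * f (\<tau> s) else 0)"
      by (rule sum.cong) (simp_all add: H_def)
    then show ?thesis by simp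
  qed
  have HH: "H ** H = mat 1"
    unfolding matrix_matrix_mult_def H_row by (simp add: vec_eq_iff mat_def) (simp add: H_def \<tau> h)
  moreover have "conj_transpose H $ s $ r = H $ s $ r" for s r
    \<comment> \<open>\<open>H\<close> is Hermitian, so \<open>H ** H = mat 1\<close> also says that
      it is symplectic.\<close>
    by (cases "r = \<tau> s") (auto simp: conj_transpose_def H_def \<tau> h)
  then have "conj_transpose H = H" by (simp add: vec_eq_iff)
  moreover from HH this have "H \<in> carrier Sp" by (simp add: carrier_Sp)
  moreover have "H ** qdiag (\<lambda>s. qcis (\<theta> s)) = qdiag (\<lambda>s. qcis (- \<theta> s)) ** H"
    by (simp add: vec_eq_iff mult_qdiag qdiag_mult H_def \<theta>\<tau> hq)
  moreover have "H *v x = - x" if "\<And>s. \<theta> s \<noteq> 0 \<Longrightarrow> x $ s = 0" for x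
  proof -
    have "h s * x $ \<tau> s = - x $ s" for s
      using that[of s] that[of "\<tau> s"] h0[of s] \<theta>\<tau>[of s] by (cases "\<theta> s = 0") auto
    then show ?thesis
      unfolding matrix_vector_mult_def H_row by (simp add: vec_eq_iff)
  qed
  ultimately show ?thesis using that[of H] by blast
qed

section \<open>Transfer between an element and its diagonal form\<close>

lemma conj_transpose_qdiag_qcis:
  "conj_transpose (qdiag (\<lambda>s. qcis (\<theta> s))) = qdiag (\<lambda>s. qcis (- \<theta> s))"
  by (auto simp: vec_eq_iff conj_transpose_def qdiag_def qcnj_qcis)

lemma qdiag_qcis_in_Sp: "qdiag (\<lambda>s. qcis (\<theta> s)) \<in> carrier Sp"
  unfolding carrier_Sp conj_transpose_qdiag_qcis
  by (simp add: vec_eq_iff qdiag_mult) (simp add: qdiag_def mat_def)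

lemma Sp_strongly_reversible_imp_even:
  fixes A :: "quat^'n^'n"
  assumes A: "A \<in> carrier Sp" and \<theta>: "diagonal_angles A \<theta>" and rev: "strongly_reversible Sp A"
  shows "\<theta> s = 0 \<or> \<theta> s = pi \<or> even (card {r. \<theta> r = \<theta> s})"
proof -
  interpret Sp: group "Sp :: (quat^'n^'n) monoid" by (rule group_Sp)
  have bounds: "\<theta> r \<in> {0..pi}" for r using \<theta> by (simp add: diagonal_angles_def)
  obtain U where U: "U \<in> carrier Sp"
    and D: "U \<otimes>\<^bsub>Sp\<^esub> A \<otimes>\<^bsub>Sp\<^esub> inv\<^bsub>Sp\<^esub> U = qdiag (\<lambda>s. qcis (\<theta> s))"
    using \<theta> unfolding diagonal_angles_def by blast
  have "strongly_reversible Sp (qdiag (\<lambda>s. qcis (\<theta> s)))"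
    using Sp.strongly_reversible_conj[OF A U rev] by (simp only: D)
  then obtain H where "H ** H = mat 1"
    "H ** qdiag (\<lambda>s. qcis (\<theta> s)) = qdiag (\<lambda>s. qcis (- \<theta> s)) ** H"
    by (auto simp: Sp_strongly_reversible_iff[OF qdiag_qcis_in_Sp] conj_transpose_qdiag_qcis)
  then have "even (card {r. \<theta> r = \<theta> s})" if "0 < \<theta> s" "\<theta> s < pi"
    using even_card_of_reversing_involution[of H \<theta> "\<theta> s"] bounds that by blast
  then show ?thesis using bounds[of s] by (cases "0 < \<theta> s \<and> \<theta> s < pi") auto
qed

text \<open>Conjugation by \<open>(U, b)\<close> turns \<open>(A, w)\<close> into
  \<open>(?D, x)\<close> with \<open>x\<close> fixed by \<open>?D\<close>. The linear involution
  \<open>(H, 0)\<close> then reverses it, because \<open>H\<close> reverses \<open>?D\<close> and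
  negates \<open>x\<close>.\<close>

lemma Sp_affine_strongly_reversible_of_even:
  fixes A :: "quat^'n^'n"
  assumes A: "A \<in> carrier Sp" and \<theta>: "diagonal_angles A \<theta>"
    and even: "\<And>s. \<theta> s = 0 \<or> \<theta> s = pi \<or> even (card {r. \<theta> r = \<theta> s})"
  shows "strongly_reversible Sp_affine (A, w)"
proof -
  interpret G: group "Sp_affine :: ((quat^'n^'n) \<times> (quat^'n)) monoid" by (rule group_Sp_affine)
  let ?D = "qdiag (\<lambda>s. qcis (\<theta> s))"
  have bounds: "\<theta> r \<in> {0..pi}" for r using \<theta> by (simp add: diagonal_angles_def)
  have D: "?D \<in> carrier Sp" by (rule qdiag_qcis_in_Sp)
  obtain U where U: "U \<in> carrier Sp" and UAU: "U ** A ** conj_transpose U = ?D"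
    using diagonal_angles_obtain[OF \<theta>] by blast
  \<comment> \<open>Solves \<open>(1 - qcis (\<theta> s)) * b $ s = - (U *v w) $ s\<close> where the
    angle is nonzero, which kills that coordinate of the translation. At the angle 0 the inverse of
    0 is 0, and the contribution of \<open>b\<close> to \<open>x\<close> cancels anyway.\<close>
  define b where "b = (\<chi> s. - (inverse (1 - qcis (\<theta> s)) * (U *v w) $ s))"
  define x where "x = U *v w + b - ?D *v b"
  have x: "x $ s = 0" if "\<theta> s \<noteq> 0" for s
  proof -
    have "cos (\<theta> s) \<noteq> cos 0" using bounds[of s] that cos_inj_pi[of "\<theta> s" 0] by auto
    then have "1 - qcis (\<theta> s) \<noteq> 0" by (auto simp: quat_eq_iff)
    then have "(1 - qcis (\<theta> s)) * b $ s = - (U *v w) $ s"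
      by (simp add: b_def flip: mult.assoc)
    then show ?thesis by (simp add: x_def qdiag_mult_vec algebra_simps)
  qed
  obtain H where H: "H \<in> carrier Sp" "H ** H = mat 1" "H ** ?D = conj_transpose ?D ** H"
    and Hx: "H *v x = - x"
    using reversing_involution_exists[OF even] x unfolding conj_transpose_qdiag_qcis by metis
  have "conj_transpose ?D *v x = x"
    unfolding conj_transpose_qdiag_qcis qdiag_mult_vec vec_eq_iff
    by (metis x minus_zero mult_zero_right mult_1_left qcis_0 vec_lambda_beta)
  then have rev: "strongly_reversible Sp_affine (?D, x)"
    unfolding Sp_affine_strongly_reversible_iff[OF D] using H Hx
    by (intro bexI[of _ H] exI[of _ 0]) simp_all
  define k where "k = (U, b)"
  have k: "k \<in> carrier Sp_affine" and g: "(A, w) \<in> carrier Sp_affine"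
    using U A by (simp_all add: k_def Sp_affine_carrier)
  have "U *v (A *v (conj_transpose U *v b)) = ?D *v b"
    by (simp add: matrix_vector_mul_assoc matrix_mul_assoc UAU)
  then have kgk: "k \<otimes>\<^bsub>Sp_affine\<^esub> (A, w) \<otimes>\<^bsub>Sp_affine\<^esub> inv\<^bsub>Sp_affine\<^esub> k = (?D, x)"
    by (simp add: k_def Sp_affine_inv[OF U] Sp_affine_mult UAU x_def linear_neg[OF linear_mult_vec]
        flip: matrix_vector_mul_assoc)
  have "inv\<^bsub>Sp_affine\<^esub> k \<otimes>\<^bsub>Sp_affine\<^esub> (?D, x) \<otimes>\<^bsub>Sp_affine\<^esub> inv\<^bsub>Sp_affine\<^esub> (inv\<^bsub>Sp_affine\<^esub> k) = (A, w)"
    unfolding kgk[symmetric] using k g by (simp add: G.m_assoc) (simp flip: G.m_assoc)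
  then show ?thesis
    using G.strongly_reversible_conj[of "(?D, x)" "inv\<^bsub>Sp_affine\<^esub> k"] rev D k
    by (simp add: Sp_affine_carrier)
qed

theorem theorem1p4:
  fixes A :: "quat^'n^'n" and w :: "quat^'n"
  assumes "(A, w) \<in> carrier Sp_affine"
  shows "(strongly_reversible Sp_affine (A, w) \<longleftrightarrow>
           (\<forall>C\<in>eigenvalue_classes A.
              C = similarity_class 1 \<or> C = similarity_class (- 1) \<or> even (class_multiplicity A C)))
       \<and> ((\<forall>C\<in>eigenvalue_classes A.
              C = similarity_class 1 \<or> C = similarity_class (- 1) \<or> even (class_multiplicity A C))
           \<longleftrightarrow> strongly_reversible Sp A)"
proof -
  have A: "A \<in> carrier Sp" using assms by (simp add: Sp_affine_carrier)
  obtain \<theta> where \<theta>: "diagonal_angles A \<theta>" using Sp_diagonalisable[OF A] .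
  \<comment> \<open>The implications run in a cycle: affine reversibility gives an involution whose
    linear part reverses \<open>A\<close>; this gives even multiplicities, and these give affine
    reversibility.\<close>
  have "strongly_reversible Sp A" if "strongly_reversible Sp_affine (A, w)"
    using that by (auto simp: Sp_affine_strongly_reversible_iff[OF A] Sp_strongly_reversible_iff[OF A])
  with Sp_strongly_reversible_imp_even[OF A \<theta>] Sp_affine_strongly_reversible_of_even[OF A \<theta>]
  show ?thesis unfolding even_multiplicities_iff[OF \<theta>] by blast
qed

end
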